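(* Let $R$ be a $*$-ring and let $a,b,c\in R$. Then the following are equivalent: (1) $a$ has a left hybrid core-$(b,c)$-inverse, i.e. $a\in R_{lh(b,c)}^{\mathrm{core}}$. (2) $a$ is core invertible (i.e. $a\in R^{\mathrm{core}}$), $\ell(a)=\ell(b)$ and $Ra^*=Rc$. (3) $a$ has a left hybrid $(b,c)$-inverse (i.e. $a\in R_{lh}^{(b,c)}$), $\ell(a)=\ell(b)$ and $Ra^*=Rc$.
   Context: A $*$-ring is an associative ring with identity with an involution $x\mapsto x^*$ satisfying $(x+y)^*=x^*+y^*$, $(xy)^*=y^*x^*$, $(x^* )^*=x$. For $x\in R$, $\ell(x)=\{r\in R: rx=0\}$ and $r(x)=\{r\in R: xr=0\}$. Core inverse: $a\in R$ is core invertible if there is $x\in R$ with $ax^2=x$, $(ax)^*=ax$, $xa^2=a$; such $x$ is unique and denoted $a^{\mathrm{core}}$; $R^{\mathrm{core}}$ is the set of core invertible elements. Left hybrid $(b,c)$-inverse: $a\in R_{lh}^{(b,c)}$ if there is $x\in R$ with $xax=x$, $\ell(x)=\ell(b)$, $Rx=Rc$; such $x$ is unique and denoted $a_{lh}^{(b,c)}$. Left hybrid core-$(b,c)$-inverse: $a\in R_{lh(b,c)}^{\mathrm{core}}$ if $a\in R^{\mathrm{core}}$, $a\in R_{lh}^{(b,c)}$ and $a^{\mathrm{core}}=a_{lh}^{(b,c)}$. *)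

theory Defs
  imports Main
begin

text \<open>
  The base class is \<open>ring + monoid_mult\<close> rather than \<open>ring_1\<close>, because the latter
  demands \<open>0 \<noteq> 1\<close> and would exclude the zero ring.
\<close>

class star_ring = ring + monoid_mult +
  fixes star :: "'a \<Rightarrow> 'a"
  assumes star_add: "star (x + y) = star x + star y"
    and star_mult: "star (x * y) = star y * star x"
    and star_star: "star (star x) = x"

definition left_ann :: "'a::star_ring \<Rightarrow> 'a set"
  where "left_ann x = {r. r * x = 0}"

definition left_principal :: "'a::star_ring \<Rightarrow> 'a set"
  where "left_principal x = {r * x | r. True}"

definition is_core_inverse :: "'a::star_ring \<Rightarrow> 'a \<Rightarrow> bool"
  where "is_core_inverse a x \<longleftrightarrow> a * x ^ 2 = x \<and> star (a * x) = a * x \<and> x * a ^ 2 = a"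

definition core_invertible :: "'a::star_ring \<Rightarrow> bool"
  where "core_invertible a \<longleftrightarrow> (\<exists>x. is_core_inverse a x)"

definition core_inverse :: "'a::star_ring \<Rightarrow> 'a"
  where "core_inverse a = (THE x. is_core_inverse a x)"

definition is_lh_inverse :: "'a::star_ring \<Rightarrow> 'a \<Rightarrow> 'a \<Rightarrow> 'a \<Rightarrow> bool"
  where "is_lh_inverse b c a x \<longleftrightarrow>
    x * a * x = x \<and> left_ann x = left_ann b \<and> left_principal x = left_principal c"

definition lh_invertible :: "'a::star_ring \<Rightarrow> 'a \<Rightarrow> 'a \<Rightarrow> bool"
  where "lh_invertible b c a \<longleftrightarrow> (\<exists>x. is_lh_inverse b c a x)"

definition lh_inverse :: "'a::star_ring \<Rightarrow> 'a \<Rightarrow> 'a \<Rightarrow> 'a"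
  where "lh_inverse b c a = (THE x. is_lh_inverse b c a x)"

definition lh_core_invertible :: "'a::star_ring \<Rightarrow> 'a \<Rightarrow> 'a \<Rightarrow> bool"
  where "lh_core_invertible b c a \<longleftrightarrow>
    core_invertible a \<and> lh_invertible b c a \<and> core_inverse a = lh_inverse b c a"

text \<open>Both inverses are unique, so the definite descriptions above are meaningful.\<close>

lemma is_core_inverse_unique:
  fixes a x y :: "'a::star_ring"
  assumes "is_core_inverse a x" and "is_core_inverse a y"
  shows "x = y"
proof -
  have x: "a * (x * x) = x" "star (a * x) = a * x" "x * (a * a) = a"
    and y: "a * (y * y) = y" "star (a * y) = a * y" "y * (a * a) = a"
    using assms by (auto simp: is_core_inverse_def power2_eq_square)
  have inner: "a * z * a = a" if "a * (z * z) = z" "z * (a * a) = a" for z :: 'a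
    using that by (metis mult.assoc)
  have "a * x = (a * y) * (a * x)"
    using inner[OF y(1,3)] by (metis mult.assoc)
  then have "a * x = (a * x) * (a * y)"
    using x(2) y(2) by (metis star_mult)
  then have ax: "a * x = a * y"
    using inner[OF x(1,3)] by (metis mult.assoc)
  have "x = x * (a * x)"
    using x(1,3) by (metis mult.assoc)
  also have "\<dots> = x * (a * (a * (y * y)))"
    using ax y(1) by simp
  also have "\<dots> = x * (a * a) * (y * y)"
    by (simp add: mult.assoc)
  also have "\<dots> = y"
    using x(3) y(1) by simp
  finally show ?thesis .
qed

lemma is_lh_inverse_unique:
  fixes a b c x y :: "'a::star_ring"
  assumes "is_lh_inverse b c a x" and "is_lh_inverse b c a y"
  shows "x = y"
proof -
  have x: "x * a * x = x" and y: "y * a * y = y"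
    and ann: "left_ann x = left_ann y" and gen: "left_principal x = left_principal y"
    using assms by (auto simp: is_lh_inverse_def)
  have "x * a - 1 \<in> left_ann x"
    using x by (simp add: left_ann_def left_diff_distrib)
  then have "x * a - 1 \<in> left_ann y"
    using ann by simp
  then have "x * a * y = y"
    by (simp add: left_ann_def left_diff_distrib)
  moreover have "x \<in> left_principal x"
    unfolding left_principal_def by (rule CollectI, rule exI[of _ 1]) simp
  then obtain r where "x = r * y"
    using gen by (auto simp: left_principal_def)
  then have "x * a * y = x"
    using y by (simp add: mult.assoc)
  ultimately show ?thesis by simp
qed

lemma core_inverse_eqI: "is_core_inverse a x \<Longrightarrow> core_inverse a = x"
  unfolding core_inverse_def by (blast intro: is_core_inverse_unique)

lemma lh_inverse_eqI: "is_lh_inverse b c a x \<Longrightarrow> lh_inverse b c a = x"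
  unfolding lh_inverse_def by (blast intro: is_lh_inverse_unique)

end

theory Submission imports Defs begin

text \<open>
  The core inverse of \<open>a\<close> is precisely its left hybrid \<open>(a, a\<^sup>*)\<close>-inverse, and being a
  left hybrid \<open>(b, c)\<close>-inverse depends on \<open>b\<close> and \<open>c\<close> only through the left annihilator of
  \<open>b\<close> and the left ideal generated by \<open>c\<close>.
\<close>

lemma left_ann_subset_mult: "left_ann x \<subseteq> left_ann (x * y)"
  by (auto simp: left_ann_def simp flip: mult.assoc)

lemma left_principal_mult_subset: "left_principal (y * x) \<subseteq> left_principal x"
  by (auto simp: left_principal_def simp flip: mult.assoc)

text \<open>\<open>e * x = x\<close> says that \<open>e - 1\<close> annihilates \<open>x\<close>
  from the left, so left identities depend only on the left annihilator.\<close>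

lemma left_ann_eq_cancel:
  assumes "left_ann x = left_ann y" and "e * x = x"
  shows "e * y = y"
proof -
  have "e - 1 \<in> left_ann x"
    using assms(2) by (simp add: left_ann_def left_diff_distrib)
  then have "e - 1 \<in> left_ann y"
    using assms(1) by simp
  then show ?thesis
    by (simp add: left_ann_def left_diff_distrib)
qed

text \<open>\<open>y\<close> is a left multiple of \<open>x\<close>, so right identities carry
  over.\<close>

lemma left_principal_eq_cancel:
  assumes "left_principal x = left_principal y" and "x * e = x"
  shows "y * e = y"
proof -
  have "y \<in> left_principal y"
    unfolding left_principal_def by (rule CollectI, rule exI[of _ 1]) simp
  then obtain r where "y = r * x"
    using assms(1) by (auto simp: left_principal_def)
  then show ?thesis
    using assms(2) by (simp add: mult.assoc)
qed

lemma is_core_inverse_imp_is_lh_inverse: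
  assumes "is_core_inverse a x"
  shows "is_lh_inverse a (star a) a x"
proof -
  have x: "a * (x * x) = x" "star (a * x) = a * x" "x * (a * a) = a"
    using assms by (auto simp: is_core_inverse_def power2_eq_square)
  have xax: "x * a * x = x" and axa: "a * x * a = a"
    using x(1,3) by (metis mult.assoc)+
  have "left_ann x = left_ann a"
    using left_ann_subset_mult[of a "x * x"] left_ann_subset_mult[of x "a * a"] x(1,3)
    by auto
  \<comment> \<open>Since \<open>star x * star a = star (a * x) = a * x\<close>, this is
    \<open>x * a * x = x\<close>.\<close>
  moreover have "x * star x * star a = x"
    using xax x(2) by (metis mult.assoc star_mult)
  moreover have "star a * a * x = star a"
    using axa x(2) by (metis mult.assoc star_mult)
  ultimately show ?thesis
    using left_principal_mult_subset[of "x * star x" "star a"]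
      left_principal_mult_subset[of "star a * a" x] xax
    by (auto simp: is_lh_inverse_def)
qed

lemma is_lh_inverse_imp_is_core_inverse:
  assumes "is_lh_inverse a (star a) a x"
  shows "is_core_inverse a x"
proof -
  have xax: "x * a * x = x" and ann: "left_ann x = left_ann a"
    and gen: "left_principal x = left_principal (star a)"
    using assms by (auto simp: is_lh_inverse_def)
  have xaa: "x * a * a = a"
    using left_ann_eq_cancel[OF ann xax] .
  have "star a * (a * x) = star a"
    using left_principal_eq_cancel[OF gen] xax by (simp add: mult.assoc)
  then have aax: "star (a * x) * a = a"
    by (metis star_mult star_star)
  then have "star (a * x) * (a * x) = a * x"
    by (metis mult.assoc)
  \<comment> \<open>With \<open>p = a * x\<close>, the previous step reads
    \<open>star p * p = p\<close>, and \<open>star p * p\<close> is self-adjoint.\<close>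
  then have herm: "star (a * x) = a * x"
    by (metis star_mult star_star)
  \<comment> \<open>\<open>a * x\<close> is now a left identity of \<open>a\<close>, hence of
    \<open>x\<close>.\<close>
  then have "a * x * x = x"
    using left_ann_eq_cancel[OF ann[symmetric]] aax by simp
  then show ?thesis
    using herm xaa by (simp add: is_core_inverse_def power2_eq_square mult.assoc)
qed

lemma is_core_inverse_iff_is_lh_inverse:
  "is_core_inverse a x \<longleftrightarrow> is_lh_inverse a (star a) a x"
  by (blast intro: is_core_inverse_imp_is_lh_inverse is_lh_inverse_imp_is_core_inverse)

text \<open>Uniqueness of both inverses turns equality of the definite descriptions into a common
  witness.\<close>

lemma lh_core_invertible_iff:
  "lh_core_invertible b c a \<longleftrightarrow> (\<exists>x. is_core_inverse a x \<and> is_lh_inverse b c a x)"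
  unfolding lh_core_invertible_def core_invertible_def lh_invertible_def
  by (metis core_inverse_eqI lh_inverse_eqI)

theorem theorem2p1:
  fixes a b c :: "'a::star_ring"
  shows "(lh_core_invertible b c a \<longleftrightarrow>
            core_invertible a \<and> left_ann a = left_ann b \<and>
            left_principal (star a) = left_principal c)
       \<and> (lh_core_invertible b c a \<longleftrightarrow>
            lh_invertible b c a \<and> left_ann a = left_ann b \<and>
            left_principal (star a) = left_principal c)"
  \<comment> \<open>A common \<open>x\<close> links \<open>a\<close> to \<open>b\<close> and
    \<open>star a\<close> to \<open>c\<close>; conversely, these equalities make the two inverse
    conditions on \<open>x\<close> identical.\<close>
  unfolding lh_core_invertible_iff core_invertible_def lh_invertible_def
    is_core_inverse_iff_is_lh_inverse is_lh_inverse_def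
  by auto

end
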